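(* The intersection of the varieties of binary symmetric Zinbiel algebras and binary symmetric Leibniz algebras over $\mathbb{C}$ is defined by the identities $$(x_1x_2)x_3=(-1)^{\sigma}(x_{\sigma(1)}x_{\sigma(2)})x_{\sigma(3)}\quad\text{and}\quad x_1(x_2x_3)=(-1)^{\sigma}x_{\sigma(1)}(x_{\sigma(2)}x_{\sigma(3)}),\qquad \sigma\in\mathbb{S}_3,$$ where $(-1)^\sigma$ is the sign of the permutation $\sigma$.
   Context: Algebras are over $\mathbb{C}$ and not assumed associative. An algebra is symmetric Zinbiel if $(xy)z=x(yz)+x(zy)$ and $x(yz)=(xy)z+(yx)z$ for all $x,y,z$. An algebra is symmetric Leibniz if it is both left Leibniz, $x(yz)=(xy)z+y(xz)$, and right Leibniz, $(xy)z=(xz)y+x(yz)$, for all $x,y,z$. For a variety $\Omega$ of algebras, an algebra is called binary-$\Omega$ if each of its two-generated subalgebras (subalgebras generated by two elements) belongs to $\Omega$. *)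

theory Defs
  imports Complex_Main "HOL-Combinatorics.Permutations"
begin

text \<open>
  A complex, not necessarily associative algebra has as underlying space a linear subspace A of an
  ambient complex vector space (A may be everything), so that a subalgebra is again an
  algebra in the same sense, with the same operations. The values of the multiplication outside A
  are irrelevant.
\<close>

locale complex_algebra = vector_space scale
  for scale :: "complex \<Rightarrow> 'a::ab_group_add \<Rightarrow> 'a" +
  fixes mul :: "'a \<Rightarrow> 'a \<Rightarrow> 'a" (infixl \<open>\<bullet>\<close> 70)
    and A :: "'a set"
  assumes subspace_carrier: "subspace A"
    and mul_closed: "\<lbrakk>x \<in> A; y \<in> A\<rbrakk> \<Longrightarrow> x \<bullet> y \<in> A"
    and mul_add_left: "\<lbrakk>x \<in> A; y \<in> A; z \<in> A\<rbrakk> \<Longrightarrow> (x + y) \<bullet> z = x \<bullet> z + y \<bullet> z"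
    and mul_add_right: "\<lbrakk>x \<in> A; y \<in> A; z \<in> A\<rbrakk> \<Longrightarrow> x \<bullet> (y + z) = x \<bullet> y + x \<bullet> z"
    and mul_scale_left: "\<lbrakk>x \<in> A; y \<in> A\<rbrakk> \<Longrightarrow> scale c x \<bullet> y = scale c (x \<bullet> y)"
    and mul_scale_right: "\<lbrakk>x \<in> A; y \<in> A\<rbrakk> \<Longrightarrow> x \<bullet> scale c y = scale c (x \<bullet> y)"
begin

definition subalgebra :: "'a set \<Rightarrow> bool" where
  "subalgebra B \<longleftrightarrow> B \<subseteq> A \<and> subspace B \<and> (\<forall>x\<in>B. \<forall>y\<in>B. x \<bullet> y \<in> B)"

definition generated_subalgebra :: "'a set \<Rightarrow> 'a set" where
  "generated_subalgebra S = subalgebra hull S"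

lemma subalgebra_carrier: "subalgebra A"
  unfolding subalgebra_def using subspace_carrier mul_closed by blast

lemma subalgebra_generated:
  assumes "S \<subseteq> A"
  shows "subalgebra (generated_subalgebra S)"
proof -
  have "generated_subalgebra S \<subseteq> A"
    unfolding generated_subalgebra_def
    using subalgebra_carrier assms by (rule hull_minimal[rotated])
  then show ?thesis
    unfolding generated_subalgebra_def hull_def subalgebra_def
    by (auto simp: subspace_def)
qed

lemma complex_algebra_subalgebra:
  assumes "subalgebra B"
  shows "complex_algebra scale (\<bullet>) B"
proof
  show "subspace B"
    using assms by (simp add: subalgebra_def)
qed (use assms in \<open>auto simp: subalgebra_def subset_eq mul_add_left mul_add_right
       mul_scale_left mul_scale_right\<close>)

end

locale symmetric_zinbiel_algebra = complex_algebra scale mul A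
  for scale :: "complex \<Rightarrow> 'a::ab_group_add \<Rightarrow> 'a"
    and mul :: "'a \<Rightarrow> 'a \<Rightarrow> 'a" (infixl \<open>\<bullet>\<close> 70)
    and A :: "'a set" +
  assumes zinbiel_left: "\<lbrakk>x \<in> A; y \<in> A; z \<in> A\<rbrakk> \<Longrightarrow> (x \<bullet> y) \<bullet> z = x \<bullet> (y \<bullet> z) + x \<bullet> (z \<bullet> y)"
    and zinbiel_right: "\<lbrakk>x \<in> A; y \<in> A; z \<in> A\<rbrakk> \<Longrightarrow> x \<bullet> (y \<bullet> z) = (x \<bullet> y) \<bullet> z + (y \<bullet> x) \<bullet> z"

locale left_leibniz_algebra = complex_algebra scale mul A
  for scale :: "complex \<Rightarrow> 'a::ab_group_add \<Rightarrow> 'a"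
    and mul :: "'a \<Rightarrow> 'a \<Rightarrow> 'a" (infixl \<open>\<bullet>\<close> 70)
    and A :: "'a set" +
  assumes left_leibniz: "\<lbrakk>x \<in> A; y \<in> A; z \<in> A\<rbrakk> \<Longrightarrow> x \<bullet> (y \<bullet> z) = (x \<bullet> y) \<bullet> z + y \<bullet> (x \<bullet> z)"

locale right_leibniz_algebra = complex_algebra scale mul A
  for scale :: "complex \<Rightarrow> 'a::ab_group_add \<Rightarrow> 'a"
    and mul :: "'a \<Rightarrow> 'a \<Rightarrow> 'a" (infixl \<open>\<bullet>\<close> 70)
    and A :: "'a set" +
  assumes right_leibniz: "\<lbrakk>x \<in> A; y \<in> A; z \<in> A\<rbrakk> \<Longrightarrow> (x \<bullet> y) \<bullet> z = (x \<bullet> z) \<bullet> y + x \<bullet> (y \<bullet> z)"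

locale symmetric_leibniz_algebra = left_leibniz_algebra + right_leibniz_algebra

text \<open>
  A class of algebras is a predicate on triples of scalar multiplication, multiplication and
  carrier. The two generators below need not be distinct.
\<close>

definition binary ::
  "((complex \<Rightarrow> 'a \<Rightarrow> 'a) \<Rightarrow> ('a \<Rightarrow> 'a \<Rightarrow> 'a) \<Rightarrow> 'a set \<Rightarrow> bool) \<Rightarrow>
    (complex \<Rightarrow> 'a::ab_group_add \<Rightarrow> 'a) \<Rightarrow> ('a \<Rightarrow> 'a \<Rightarrow> 'a) \<Rightarrow> 'a set \<Rightarrow> bool" where
  "binary \<Omega> scale mul A \<longleftrightarrow> complex_algebra scale mul A \<and>
    (\<forall>a\<in>A. \<forall>b\<in>A. \<Omega> scale mul (complex_algebra.generated_subalgebra scale mul A {a, b}))"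

end

theory Submission
  imports Defs
begin

text \<open>
  In an algebra satisfying both sets of laws the products (xx)z, (xz)z, x(xz) and x(zz) vanish,
  by cancellation; linearizing, (xy)z and x(yz) are alternating. Conversely, if both are
  alternating, then in the subalgebra generated by a and b every product of three
  elements is zero, so that all the laws hold trivially. Indeed it is spanned by a, b and their
  products of two factors: products of three generators vanish, and (pq)(rs), for generators
  p, q, r, s, equals ((rs)p)q = 0.
\<close>

section \<open>Sign symmetry under permutations of three arguments\<close>

lemma transpositions_within_123:
  assumes "i \<in> {1, 2, 3::nat}" and "j \<in> {1, 2, 3}" and "i \<noteq> j"
  shows "transpose i j \<in> {transpose 1 2, transpose 2 3, transpose 1 3}"
  using assms by (auto simp: transpose_commute)

context complex_algebra
begin

text \<open>The type \<open>'a\<close> is only an abelian group and could have 2-torsion; it is the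
  action of the complex scalars, in which 2 is invertible, that excludes this.\<close>

lemma eq_minus_self_iff_zero: "(v::'a) = - v \<longleftrightarrow> v = 0"
proof
  assume "v = - v"
  then have "v + v = 0"
    by (metis add.right_inverse)
  then have "scale 2 v = 0"
    by (metis one_add_one scale_left_distrib scale_one)
  then show "v = 0"
    by simp
qed simp

text \<open>The adjacent transpositions (1 2) and (2 3) are odd and generate the symmetric group on
  three letters. \<open>T\<close> is left abstract so that it can stand for either bracketing of a
  triple product.\<close>

lemma sign_symmetric_iff:
  fixes T :: "'a \<Rightarrow> 'a \<Rightarrow> 'a \<Rightarrow> 'a"
  shows "(\<forall>\<sigma> x. \<sigma> permutes {1, 2, 3::nat} \<longrightarrow> x 1 \<in> A \<longrightarrow> x 2 \<in> A \<longrightarrow> x 3 \<in> A \<longrightarrow>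
            T (x 1) (x 2) (x 3) = scale (of_int (sign \<sigma>)) (T (x (\<sigma> 1)) (x (\<sigma> 2)) (x (\<sigma> 3)))) \<longleftrightarrow>
         (\<forall>x\<in>A. \<forall>y\<in>A. \<forall>z\<in>A. T x y z = - T y x z \<and> T x y z = - T x z y)"
    (is "?sym \<longleftrightarrow> ?skew")
proof
  assume sym: ?sym
  show ?skew
  proof (intro ballI)
    fix x y z assume "x \<in> A" "y \<in> A" "z \<in> A"
    \<comment> \<open>The permutation identities speak of families indexed by naturals, so the three
      elements are packed into one; every index other than 1 and 2 gives \<open>z\<close>.\<close>
    define v where "v = (\<lambda>i::nat. if i = 1 then x else if i = 2 then y else z)"
    have v: "v 1 = x" "v (Suc 0) = x" "v 2 = y" "v 3 = z"
      by (simp_all add: v_def)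
    have swap: "T x y z = - T (v (transpose i j 1)) (v (transpose i j 2)) (v (transpose i j 3))"
      if "i \<in> {1, 2, 3}" "j \<in> {1, 2, 3}" "i \<noteq> j" for i j
      using sym[rule_format, of "transpose i j" v] permutes_swap_id[OF that(1,2)] that(3)
        \<open>x \<in> A\<close> \<open>y \<in> A\<close> \<open>z \<in> A\<close>
      by (simp add: v sign_swap_id)
    show "T x y z = - T y x z \<and> T x y z = - T x z y"
      using swap[of 1 2] swap[of 2 3] by (simp add: v transpose_def)
  qed
next
  assume skew: ?skew
  have fin: "finite {1, 2, 3::nat}"
    by simp
  have "\<forall>x. x 1 \<in> A \<longrightarrow> x 2 \<in> A \<longrightarrow> x 3 \<in> A \<longrightarrow>
      T (x 1) (x 2) (x 3) = scale (of_int (sign \<sigma>)) (T (x (\<sigma> 1)) (x (\<sigma> 2)) (x (\<sigma> 3)))"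
    if "\<sigma> permutes {1, 2, 3::nat}" for \<sigma>
    using that fin
  proof (induction \<sigma> rule: permutes_induct)
    case id
    then show ?case by simp
  next
    case (swap i j \<sigma>)
    show ?case
    proof (intro allI impI)
      fix x :: "nat \<Rightarrow> 'a" assume x: "x 1 \<in> A" "x 2 \<in> A" "x 3 \<in> A"
      \<comment> \<open>The new transposition is composed on the left of \<open>\<sigma>\<close>, so
        it can be absorbed into the family: the induction hypothesis, which holds for all families,
        is applied to \<open>?x\<close>.\<close>
      let ?x = "x \<circ> transpose i j"
      have mem: "?x 1 \<in> A" "?x 2 \<in> A" "?x 3 \<in> A"
        using x swap.hyps(1,2) by (auto simp: transpose_def)
      have step: "T (x 1) (x 2) (x 3) = - T (?x 1) (?x 2) (?x 3)"
      proof -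
        \<comment> \<open>The third equation holds because (1 3) is a product of three adjacent
          transpositions, giving the sign \<open>(-1)^3\<close>.\<close>
        have "T (x 1) (x 2) (x 3) = - T (x 2) (x 1) (x 3)"
            "T (x 1) (x 2) (x 3) = - T (x 1) (x 3) (x 2)"
            "T (x 1) (x 2) (x 3) = - T (x 3) (x 2) (x 1)"
          using skew x by metis+
        then show ?thesis
          using transpositions_within_123[OF swap.hyps(1-3)]
          by (elim insertE emptyE) (simp_all add: transpose_def)
      qed
      have "sign (transpose i j \<circ> \<sigma>) = - sign \<sigma>"
        using permutes_imp_permutation[OF fin swap.hyps(4)] swap.hyps(3)
        by (simp add: sign_compose sign_swap_id permutation_swap_id)
      with step swap.IH[rule_format, OF mem]
      show "T (x 1) (x 2) (x 3) = scale (of_int (sign (transpose i j \<circ> \<sigma>)))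
          (T (x ((transpose i j \<circ> \<sigma>) 1)) (x ((transpose i j \<circ> \<sigma>) 2)) (x ((transpose i j \<circ> \<sigma>) 3)))"
        by simp
    qed
  qed
  then show ?sym by blast
qed

section \<open>Extending products from spanning sets to spans\<close>

lemma mul_zero:
  assumes "x \<in> A"
  shows "0 \<bullet> x = 0" "x \<bullet> 0 = 0"
  using mul_scale_left[OF assms assms, of 0] mul_scale_right[OF assms assms, of 0] by simp_all

text \<open>One argument is extended at a time: with the other fixed, the elements whose product
  lies in \<open>V\<close> form a subspace. These sets are cut down to \<open>A\<close>, where
  multiplication is bilinear.\<close>

lemma mul_span_mem:
  assumes "S \<subseteq> A" "R \<subseteq> A" and "subspace V"
    and prod: "\<And>x y. x \<in> S \<Longrightarrow> y \<in> R \<Longrightarrow> x \<bullet> y \<in> V"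
    and "x \<in> span S" "y \<in> span R"
  shows "x \<bullet> y \<in> V"
proof -
  have SA: "span S \<subseteq> A" and RA: "span R \<subseteq> A"
    using assms(1,2) by (simp_all add: span_minimal subspace_carrier)
  have gen: "s \<bullet> y \<in> V" if s: "s \<in> S" for s
  proof -
    have "s \<in> A" using s assms(1) by auto
    have "subspace {y \<in> A. s \<bullet> y \<in> V}"
      using \<open>subspace V\<close> subspace_carrier \<open>s \<in> A\<close>
      by (auto simp: subspace_def mul_zero mul_add_right mul_scale_right)
    moreover have "R \<subseteq> {y \<in> A. s \<bullet> y \<in> V}"
      using assms(2) prod s by auto
    ultimately show ?thesis
      using span_minimal[of R "{y \<in> A. s \<bullet> y \<in> V}"] \<open>y \<in> span R\<close> by blast
  qed
  have "y \<in> A" using \<open>y \<in> span R\<close> RA by auto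
  then have "subspace {x \<in> A. x \<bullet> y \<in> V}"
    using \<open>subspace V\<close> subspace_carrier
    by (auto simp: subspace_def mul_zero mul_add_left mul_scale_left)
  moreover have "S \<subseteq> {x \<in> A. x \<bullet> y \<in> V}"
    using assms(1) gen by auto
  ultimately show ?thesis
    using span_minimal[of S "{x \<in> A. x \<bullet> y \<in> V}"] \<open>x \<in> span S\<close> by blast
qed

section \<open>From the binary laws to skew symmetry\<close>

lemma generators_subset_generated: "S \<subseteq> generated_subalgebra S"
  unfolding generated_subalgebra_def by (rule hull_subset)

text \<open>Polarization: expand \<open>T (x + y) (x + y) = 0\<close> and drop the two diagonal
  terms.\<close>

lemma alternating_imp_skew:
  fixes T :: "'a \<Rightarrow> 'a \<Rightarrow> 'a"
  assumes add_left: "\<And>x y z. \<lbrakk>x \<in> A; y \<in> A; z \<in> A\<rbrakk> \<Longrightarrow> T (x + y) z = T x z + T y z"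
    and add_right: "\<And>x y z. \<lbrakk>x \<in> A; y \<in> A; z \<in> A\<rbrakk> \<Longrightarrow> T x (y + z) = T x y + T x z"
    and alt: "\<And>x. x \<in> A \<Longrightarrow> T x x = 0"
    and "x \<in> A" "y \<in> A"
  shows "T x y = - T y x"
proof -
  have "x + y \<in> A"
    using assms subspace_add subspace_carrier by blast
  then have "T (x + y) (x + y) = T x y + T y x"
    using \<open>x + y \<in> A\<close> \<open>x \<in> A\<close> \<open>y \<in> A\<close>
    by (simp add: add_left add_right alt[of x] alt[of y])
  then show ?thesis
    using alt[OF \<open>x + y \<in> A\<close>] by (simp add: eq_neg_iff_add_eq_0)
qed

text \<open>Each identity involves only two elements, so the laws are available in the subalgebra
  that these generate.\<close>

lemma binary_zinbiel_leibniz_alternating: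
  assumes "binary symmetric_zinbiel_algebra scale (\<bullet>) A"
    and "binary symmetric_leibniz_algebra scale (\<bullet>) A"
    and "x \<in> A" "z \<in> A"
  shows "(x \<bullet> x) \<bullet> z = 0" "(x \<bullet> z) \<bullet> z = 0" "x \<bullet> (x \<bullet> z) = 0" "x \<bullet> (z \<bullet> z) = 0"
proof -
  let ?B = "generated_subalgebra {x, z}"
  interpret Z: symmetric_zinbiel_algebra scale "(\<bullet>)" ?B
    using assms by (auto simp: binary_def)
  interpret L: symmetric_leibniz_algebra scale "(\<bullet>)" ?B
    using assms by (auto simp: binary_def)
  have mem: "x \<in> ?B" "z \<in> ?B"
    using generators_subset_generated[of "{x, z}"] by auto
  \<comment> \<open>With a repeated argument, each Leibniz law has the same term on both sides, and
    the remaining term must vanish. Each Zinbiel law then expresses its left side as twice a product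
    already known to be zero.\<close>
  show xxz: "(x \<bullet> x) \<bullet> z = 0"
    using L.left_leibniz[of x x z] mem by simp
  show xzz: "x \<bullet> (z \<bullet> z) = 0"
    using L.right_leibniz[of x z z] mem by simp
  show "x \<bullet> (x \<bullet> z) = 0"
    using Z.zinbiel_right[of x x z] mem xxz by simp
  show "(x \<bullet> z) \<bullet> z = 0"
    using Z.zinbiel_left[of x z z] mem xzz by simp
qed

lemma binary_zinbiel_leibniz_skew:
  assumes "binary symmetric_zinbiel_algebra scale (\<bullet>) A"
    and "binary symmetric_leibniz_algebra scale (\<bullet>) A"
    and "x \<in> A" "y \<in> A" "z \<in> A"
  shows "(x \<bullet> y) \<bullet> z = - ((y \<bullet> x) \<bullet> z)" "(x \<bullet> y) \<bullet> z = - ((x \<bullet> z) \<bullet> y)"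
    "x \<bullet> (y \<bullet> z) = - (y \<bullet> (x \<bullet> z))" "x \<bullet> (y \<bullet> z) = - (x \<bullet> (z \<bullet> y))"
proof -
  note alt = binary_zinbiel_leibniz_alternating[OF assms(1,2)]
  note bilinear = mul_closed mul_add_left mul_add_right
  show "(x \<bullet> y) \<bullet> z = - ((y \<bullet> x) \<bullet> z)"
    by (rule alternating_imp_skew[of "\<lambda>x y. (x \<bullet> y) \<bullet> z"]) (use assms in \<open>simp_all add: bilinear alt\<close>)
  show "(x \<bullet> y) \<bullet> z = - ((x \<bullet> z) \<bullet> y)"
    by (rule alternating_imp_skew[of "\<lambda>y z. (x \<bullet> y) \<bullet> z"]) (use assms in \<open>simp_all add: bilinear alt\<close>)
  show "x \<bullet> (y \<bullet> z) = - (y \<bullet> (x \<bullet> z))"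
    by (rule alternating_imp_skew[of "\<lambda>x y. x \<bullet> (y \<bullet> z)"]) (use assms in \<open>simp_all add: bilinear alt\<close>)
  show "x \<bullet> (y \<bullet> z) = - (x \<bullet> (z \<bullet> y))"
    by (rule alternating_imp_skew[of "\<lambda>y z. x \<bullet> (y \<bullet> z)"]) (use assms in \<open>simp_all add: bilinear alt\<close>)
qed

section \<open>Vanishing of triple products in two-generated subalgebras\<close>

lemma skew_imp_generated_nilpotent:
  assumes f: "\<And>x y z. \<lbrakk>x \<in> A; y \<in> A; z \<in> A\<rbrakk> \<Longrightarrow>
      (x \<bullet> y) \<bullet> z = - ((y \<bullet> x) \<bullet> z) \<and> (x \<bullet> y) \<bullet> z = - ((x \<bullet> z) \<bullet> y)"
    and g: "\<And>x y z. \<lbrakk>x \<in> A; y \<in> A; z \<in> A\<rbrakk> \<Longrightarrow>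
      x \<bullet> (y \<bullet> z) = - (y \<bullet> (x \<bullet> z)) \<and> x \<bullet> (y \<bullet> z) = - (x \<bullet> (z \<bullet> y))"
    and ab: "a \<in> A" "b \<in> A"
    and xyz: "x \<in> generated_subalgebra {a, b}" "y \<in> generated_subalgebra {a, b}"
      "z \<in> generated_subalgebra {a, b}"
  shows "(x \<bullet> y) \<bullet> z = 0" "x \<bullet> (y \<bullet> z) = 0"
proof -
  \<comment> \<open>\<open>S\<close> is to span a subalgebra containing \<open>a\<close> and
    \<open>b\<close>. The quadratic part \<open>Q\<close> is kept apart because it annihilates
    \<open>S\<close> from both sides.\<close>
  define Q where "Q = {p \<bullet> q |p q. p \<in> {a, b} \<and> q \<in> {a, b}}"
  define S where "S = {a, b} \<union> Q"
  have QA: "Q \<subseteq> A" and SA: "S \<subseteq> A"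
    using ab by (auto simp: S_def Q_def mul_closed)
  have f0: "(p \<bullet> q) \<bullet> r = 0" and g0: "p \<bullet> (q \<bullet> r) = 0"
    if "p \<in> {a, b}" "q \<in> {a, b}" "r \<in> {a, b}" for p q r
  proof -
    have A: "p \<in> A" "q \<in> A" "r \<in> A" using that ab by auto
    \<comment> \<open>Pigeonhole: three factors are drawn from two generators. If the equal factors
      are the outer ones, the exchange of first and third factor is needed, hence the next two
      equations.\<close>
    have "p = q \<or> q = r \<or> p = r" using that by auto
    moreover have "(p \<bullet> q) \<bullet> r = - ((r \<bullet> q) \<bullet> p)" "p \<bullet> (q \<bullet> r) = - (r \<bullet> (q \<bullet> p))"
      using f g A by metis+
    ultimately show "(p \<bullet> q) \<bullet> r = 0" "p \<bullet> (q \<bullet> r) = 0"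
      using f[OF A] g[OF A] by (metis eq_minus_self_iff_zero)+
  qed
  have QQ: "u \<bullet> v = 0" if uv: "u \<in> Q" "v \<in> Q" for u v
  proof -
    obtain p q where u: "u = p \<bullet> q" "p \<in> {a, b}" "q \<in> {a, b}"
      using uv by (auto simp: Q_def)
    obtain r s where v: "v = r \<bullet> s" "r \<in> {a, b}" "s \<in> {a, b}"
      using uv by (auto simp: Q_def)
    have A: "p \<in> A" "q \<in> A" "v \<in> A"
      using u uv ab QA by auto
    \<comment> \<open>A cyclic shift is two adjacent swaps, so the signs cancel: \<open>(p \<bullet>
      q) \<bullet> v = - ((p \<bullet> v) \<bullet> q) = (v \<bullet> p) \<bullet> q\<close>. It
      brings \<open>v = r \<bullet> s\<close> next to the generator \<open>p\<close>.\<close>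
    have "(p \<bullet> q) \<bullet> v = (v \<bullet> p) \<bullet> q"
      using f A by metis
    also have "v \<bullet> p = 0"
      using f0 u v by simp
    finally show ?thesis
      using u A by (simp add: mul_zero)
  qed
  have QS: "u \<bullet> s = 0" "s \<bullet> u = 0" if "u \<in> Q" "s \<in> S" for u s
  proof -
    obtain p q where u: "u = p \<bullet> q" "p \<in> {a, b}" "q \<in> {a, b}"
      using \<open>u \<in> Q\<close> by (auto simp: Q_def)
    have "s \<in> {a, b} \<or> s \<in> Q"
      using \<open>s \<in> S\<close> by (simp add: S_def)
    then show "u \<bullet> s = 0" "s \<bullet> u = 0"
      using QQ \<open>u \<in> Q\<close> f0[OF u(2,3)] g0[OF _ u(2,3)] unfolding u(1) by blast+
  qed
  \<comment> \<open>Landing in \<open>span Q\<close>, rather than merely \<open>span S\<close>,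
    serves twice: it makes \<open>span S\<close> closed under multiplication and puts the inner
    product of any triple product where \<open>QS\<close> kills it.\<close>
  have SS: "s \<bullet> t \<in> span Q" if "s \<in> S" "t \<in> S" for s t
  proof (cases "s \<in> Q \<or> t \<in> Q")
    case True
    then show ?thesis using QS that by (auto simp: span_zero)
  next
    case False
    then show ?thesis using that by (auto simp: S_def Q_def intro!: span_base)
  qed
  have prod: "s \<bullet> t \<in> span Q" if "s \<in> span S" "t \<in> span S" for s t
    using mul_span_mem[OF SA SA subspace_span SS that] .
  have "span Q \<subseteq> span S"
    by (rule span_mono) (auto simp: S_def)
  then have "subalgebra (span S)"
    unfolding subalgebra_def
    using span_minimal[OF SA subspace_carrier] prod by auto
  then have "generated_subalgebra {a, b} \<subseteq> span S"
    unfolding generated_subalgebra_def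
    by (rule hull_minimal[rotated]) (auto simp: S_def intro: span_base)
  then have S: "x \<in> span S" "y \<in> span S" "z \<in> span S"
    using xyz by auto
  \<comment> \<open>Vanishing is phrased as membership in the zero subspace so that
    \<open>mul_span_mem\<close> applies.\<close>
  have "(x \<bullet> y) \<bullet> z \<in> {0}"
    by (rule mul_span_mem[OF QA SA subspace_single_0 _ prod]) (use QS S in auto)
  then show "(x \<bullet> y) \<bullet> z = 0" by simp
  have "x \<bullet> (y \<bullet> z) \<in> {0}"
    by (rule mul_span_mem[OF SA QA subspace_single_0 _ _ prod]) (use QS S in auto)
  then show "x \<bullet> (y \<bullet> z) = 0" by simp
qed

section \<open>The equivalence of the binary laws with the sign identities\<close>

lemma nilpotent_imp_zinbiel_leibniz:
  assumes "\<And>x y z. \<lbrakk>x \<in> A; y \<in> A; z \<in> A\<rbrakk> \<Longrightarrow> (x \<bullet> y) \<bullet> z = 0 \<and> x \<bullet> (y \<bullet> z) = 0"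
  shows "symmetric_zinbiel_algebra scale (\<bullet>) A" "symmetric_leibniz_algebra scale (\<bullet>) A"
  by unfold_locales (simp_all add: assms)

lemma binary_zinbiel_leibniz_iff_skew:
  "binary symmetric_zinbiel_algebra scale (\<bullet>) A \<and> binary symmetric_leibniz_algebra scale (\<bullet>) A \<longleftrightarrow>
    (\<forall>x\<in>A. \<forall>y\<in>A. \<forall>z\<in>A. (x \<bullet> y) \<bullet> z = - ((y \<bullet> x) \<bullet> z) \<and> (x \<bullet> y) \<bullet> z = - ((x \<bullet> z) \<bullet> y)) \<and>
    (\<forall>x\<in>A. \<forall>y\<in>A. \<forall>z\<in>A. x \<bullet> (y \<bullet> z) = - (y \<bullet> (x \<bullet> z)) \<and> x \<bullet> (y \<bullet> z) = - (x \<bullet> (z \<bullet> y)))"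
    (is "?binary \<longleftrightarrow> ?skew")
proof
  assume ?binary
  then show ?skew
    using binary_zinbiel_leibniz_skew by blast
next
  assume skew: ?skew
  have "symmetric_zinbiel_algebra scale (\<bullet>) (generated_subalgebra {a, b}) \<and>
      symmetric_leibniz_algebra scale (\<bullet>) (generated_subalgebra {a, b})"
    if ab: "a \<in> A" "b \<in> A" for a b
  proof -
    \<comment> \<open>Taking the subalgebra itself as carrier lets
      \<open>nilpotent_imp_zinbiel_leibniz\<close> be applied to it.\<close>
    interpret B: complex_algebra scale "(\<bullet>)" "generated_subalgebra {a, b}"
      using ab by (intro complex_algebra_subalgebra subalgebra_generated) auto
    have "(x \<bullet> y) \<bullet> z = 0 \<and> x \<bullet> (y \<bullet> z) = 0"
      if "x \<in> generated_subalgebra {a, b}" "y \<in> generated_subalgebra {a, b}"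
        "z \<in> generated_subalgebra {a, b}" for x y z
      using skew_imp_generated_nilpotent[OF _ _ ab that] skew by blast
    then show ?thesis
      using B.nilpotent_imp_zinbiel_leibniz by blast
  qed
  then show ?binary
    unfolding binary_def using complex_algebra_axioms by blast
qed

end

theorem proposition23:
  fixes scale :: "complex \<Rightarrow> 'a::ab_group_add \<Rightarrow> 'a"
    and mul :: "'a \<Rightarrow> 'a \<Rightarrow> 'a" (infixl \<open>\<bullet>\<close> 70)
    and A :: "'a set"
  assumes "complex_algebra scale mul A"
  shows "binary symmetric_zinbiel_algebra scale mul A \<and> binary symmetric_leibniz_algebra scale mul A
    \<longleftrightarrow>
    (\<forall>\<sigma> x. \<sigma> permutes {1, 2, 3::nat} \<longrightarrow> x 1 \<in> A \<longrightarrow> x 2 \<in> A \<longrightarrow> x 3 \<in> A \<longrightarrow>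
      (x 1 \<bullet> x 2) \<bullet> x 3 = scale (of_int (sign \<sigma>)) ((x (\<sigma> 1) \<bullet> x (\<sigma> 2)) \<bullet> x (\<sigma> 3)) \<and>
      x 1 \<bullet> (x 2 \<bullet> x 3) = scale (of_int (sign \<sigma>)) (x (\<sigma> 1) \<bullet> (x (\<sigma> 2) \<bullet> x (\<sigma> 3))))"
proof -
  interpret complex_algebra scale mul A
    by (rule assms)
  show ?thesis
    \<comment> \<open>After rewriting, each bracketing has its own statement over all permutations;
      the two sides differ only by distributing the quantifiers over the conjunction.\<close>
    unfolding binary_zinbiel_leibniz_iff_skew
      sign_symmetric_iff[of "\<lambda>x y z. (x \<bullet> y) \<bullet> z", symmetric]
      sign_symmetric_iff[of "\<lambda>x y z. x \<bullet> (y \<bullet> z)", symmetric]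
    by blast
qed

end
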